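(* A module system on an abelian group $G$ is equivalently a nucleus $r$ on the multiplicative lattice $2^{G_0}$ such that $\emptyset^r = \{0\}$. Moreover, the following are equivalent for any self-map $r: X\mapsto X^r$ of $2^{G_0}$ such that $\emptyset^r = \{0\}$. (1) $r$ is a module system on $G$. (2) $r$ is a closure operation on the poset $2^{G_0}$ and $r$-multiplication is associative. (3) $r$ is a closure operation on the poset $2^{G_0}$ and $(X^r Y^r)^r = (XY)^r$ for all $X,Y \in 2^{G_0}$. (4) For all $X,Y,Z \subseteq G_0$: $XY \subseteq Z^r$ if and only if $XY^r \subseteq Z^r$.
   Context: For an abelian group $G$ (written multiplicatively), $G_0 = G\amalg\{0\}$ is the commutative monoid obtained by adjoining an element $0$ with $0x=0=x0$ for all $x\in G_0$. $2^{G_0}$ is the power set of $G_0$, ordered by inclusion, with multiplication $XY=\{xy: x\in X, y\in Y\}$. A closure operation on a poset is a self-map $r$ that is expansive, order-preserving and idempotent. A nucleus on $2^{G_0}$ is a closure operation $r$ with $X^rY^r\subseteq (XY)^r$ for all $X,Y$. $r$-multiplication is the binary operation $(X,Y)\mapsto (XY)^r$ on $2^{G_0}$. A module system on $G$ is a closure operation $r$ on $2^{G_0}$ such that $\emptyset^r=\{0\}$ and $(cX)^r=cX^r$ for all $c\in G_0$ and all $X\in 2^{G_0}$, where $cX = \{cx: x\in X\}$. *)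

theory Defs
  imports "HOL-Algebra.Coset" "HOL-Algebra.Complete_Lattice"
begin

text \<open>The multiplicative monoid \<open>G\<^sub>0\<close>: \<open>None\<close> is the adjoined zero and \<open>Some x\<close> is the copy of
  \<open>x \<in> carrier G\<close>. Products \<open>X Y\<close> and \<open>c X\<close> of subsets are the library's \<open>X <#> Y\<close> and \<open>c <# X\<close>.\<close>

definition adjoin_zero :: "('a, 'b) monoid_scheme \<Rightarrow> 'a option monoid" where
  "adjoin_zero G =
    \<lparr>carrier = insert None (Some ` carrier G),
     mult = (\<lambda>x y. case (x, y) of (Some a, Some b) \<Rightarrow> Some (a \<otimes>\<^bsub>G\<^esub> b) | _ \<Rightarrow> None),
     one = Some \<one>\<^bsub>G\<^esub>\<rparr>"

lemma comm_monoid_adjoin_zero: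
  assumes "comm_group G"
  shows "comm_monoid (adjoin_zero G)"
proof -
  interpret comm_group G by fact
  show ?thesis
    by (rule comm_monoidI)
       (auto simp: adjoin_zero_def m_ac split: option.splits)
qed

definition powerset_lattice :: "'a set \<Rightarrow> 'a set gorder" where
  "powerset_lattice A = \<lparr>carrier = Pow A, eq = (=), le = (\<subseteq>)\<rparr>"

definition closure_operation :: "('a, 'b) gorder_scheme \<Rightarrow> ('a \<Rightarrow> 'a) \<Rightarrow> bool" where
  "closure_operation L r \<longleftrightarrow>
    r \<in> carrier L \<rightarrow> carrier L \<and>
    (\<forall>x\<in>carrier L. x \<sqsubseteq>\<^bsub>L\<^esub> r x) \<and>
    isotone L L r \<and>
    idempotent L r"

definition nucleus :: "('a, 'b) monoid_scheme \<Rightarrow> ('a set \<Rightarrow> 'a set) \<Rightarrow> bool" where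
  "nucleus M r \<longleftrightarrow>
    closure_operation (powerset_lattice (carrier M)) r \<and>
    (\<forall>X Y. X \<subseteq> carrier M \<longrightarrow> Y \<subseteq> carrier M \<longrightarrow> r X <#>\<^bsub>M\<^esub> r Y \<subseteq> r (X <#>\<^bsub>M\<^esub> Y))"

definition closure_mult ::
    "('a, 'b) monoid_scheme \<Rightarrow> ('a set \<Rightarrow> 'a set) \<Rightarrow> 'a set \<Rightarrow> 'a set \<Rightarrow> 'a set" where
  "closure_mult M r X Y = r (X <#>\<^bsub>M\<^esub> Y)"

definition module_system ::
    "('a, 'b) monoid_scheme \<Rightarrow> ('a option set \<Rightarrow> 'a option set) \<Rightarrow> bool" where
  "module_system G r \<longleftrightarrow>
    closure_operation (powerset_lattice (carrier (adjoin_zero G))) r \<and>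
    r {} = {None} \<and>
    (\<forall>c\<in>carrier (adjoin_zero G). \<forall>X. X \<subseteq> carrier (adjoin_zero G) \<longrightarrow>
       r (c <#\<^bsub>adjoin_zero G\<^esub> X) = c <#\<^bsub>adjoin_zero G\<^esub> r X)"

end

theory Submission
  imports Defs
begin

text \<open>Everything except the translation law holds for subsets of an arbitrary commutative monoid and
  reduces to the one-sided inclusion \<open>r X Y \<subseteq> r (X Y)\<close>, which by commutativity and idempotence
  bootstraps to both factors. Invertibility of the nonzero elements is needed only to turn
  \<open>c (r X) \<subseteq> r (c X)\<close> into an equality; for \<open>c = 0\<close> both sides equal \<open>{0}\<close> because
  \<open>{0} = r {}\<close> is the least closed set.\<close>

section \<open>Closure operations on a power set\<close>

lemma closure_operation_powerset_iff:
  "closure_operation (powerset_lattice A) r \<longleftrightarrow>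
    (\<forall>X. X \<subseteq> A \<longrightarrow> X \<subseteq> r X \<and> r X \<subseteq> A \<and> r (r X) = r X) \<and>
    (\<forall>X Y. X \<subseteq> Y \<longrightarrow> Y \<subseteq> A \<longrightarrow> r X \<subseteq> r Y)"
proof -
  \<comment> \<open>\<open>isotone\<close> includes the partial order axioms of its source and
    target; discharging them here leaves only pointwise inclusions.\<close>
  have po: "weak_partial_order (powerset_lattice A)"
    by unfold_locales (auto simp: powerset_lattice_def)
  show ?thesis
    using po
    unfolding closure_operation_def isotone_def idempotent_def powerset_lattice_def Pi_def
    by (simp add: Ball_def Pow_iff) (meson subset_trans)
qed

lemma closure_operation_powersetD:
  assumes "closure_operation (powerset_lattice A) r"
  shows "X \<subseteq> A \<Longrightarrow> X \<subseteq> r X" "X \<subseteq> A \<Longrightarrow> r X \<subseteq> A" "X \<subseteq> A \<Longrightarrow> r (r X) = r X"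
    "X \<subseteq> Y \<Longrightarrow> Y \<subseteq> A \<Longrightarrow> r X \<subseteq> r Y"
  using assms unfolding closure_operation_powerset_iff by simp_all

section \<open>Products of subsets of a monoid\<close>

lemma (in monoid) subset_mult_assoc:
  assumes "X \<subseteq> carrier G" "Y \<subseteq> carrier G" "Z \<subseteq> carrier G"
  shows "(X <#> Y) <#> Z = X <#> (Y <#> Z)"
proof -
  have "(X <#> Y) <#> Z = (\<Union>x\<in>X. \<Union>y\<in>Y. \<Union>z\<in>Z. {x \<otimes> y \<otimes> z})"
    by (simp add: set_mult_def)
  also have "\<dots> = (\<Union>x\<in>X. \<Union>y\<in>Y. \<Union>z\<in>Z. {x \<otimes> (y \<otimes> z)})"
    using assms by (intro SUP_cong refl) (simp add: m_assoc subset_iff)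
  also have "\<dots> = X <#> (Y <#> Z)"
    by (simp add: set_mult_def)
  finally show ?thesis .
qed

lemma (in monoid) one_set_mult: "X \<subseteq> carrier G \<Longrightarrow> {\<one>} <#> X = X"
  by (auto simp: set_mult_def subset_iff)

lemma (in comm_monoid) subset_mult_commute:
  assumes "X \<subseteq> carrier G" "Y \<subseteq> carrier G"
  shows "X <#> Y = Y <#> X"
proof -
  have "X <#> Y = (\<Union>x\<in>X. \<Union>y\<in>Y. {y \<otimes> x})"
    unfolding set_mult_def using assms by (intro SUP_cong refl) (simp add: m_comm subset_iff)
  also have "\<dots> = Y <#> X"
    unfolding set_mult_def by (rule SUP_commute)
  finally show ?thesis .
qed

section \<open>Nuclei on the subsets of a commutative monoid\<close>

context comm_monoid
begin

lemma nucleus_one_sided_iff: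
  "nucleus G r \<longleftrightarrow> closure_operation (powerset_lattice (carrier G)) r \<and>
    (\<forall>X Y. X \<subseteq> carrier G \<longrightarrow> Y \<subseteq> carrier G \<longrightarrow> r X <#> Y \<subseteq> r (X <#> Y))"
  (is "_ \<longleftrightarrow> ?cl \<and> ?one_sided")
\<comment> \<open>Both sides contain \<open>?cl\<close>, so only the multiplicative conditions have
  to be compared.\<close>
proof (cases ?cl)
  case True
  note ext = closure_operation_powersetD(1)[OF True] and closed = closure_operation_powersetD(2)[OF True]
    and idem = closure_operation_powersetD(3)[OF True] and mono = closure_operation_powersetD(4)[OF True]
  have "r X <#> r Y \<subseteq> r (X <#> Y)"
    if ?one_sided and X: "X \<subseteq> carrier G" and Y: "Y \<subseteq> carrier G" for X Y
  proof -
    have XY: "X <#> Y \<subseteq> carrier G"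
      using X Y by (rule set_mult_closed)
    \<comment> \<open>The hypothesis with its two factors exchanged. Closing both sides then absorbs
      the closure on the second factor, and the hypothesis at \<open>X\<close>, \<open>r Y\<close>
      absorbs the one on the first.\<close>
    have "X <#> r Y \<subseteq> r (X <#> Y)"
      using \<open>?one_sided\<close> X Y subset_mult_commute[OF X closed[OF Y]] subset_mult_commute[OF X Y] by simp
    then have "r (X <#> r Y) \<subseteq> r (X <#> Y)"
      using mono[OF _ closed[OF XY]] idem[OF XY] by simp
    moreover have "r X <#> r Y \<subseteq> r (X <#> r Y)"
      using \<open>?one_sided\<close> X closed[OF Y] by simp
    ultimately show ?thesis
      by (rule subset_trans[rotated])
  qed
  moreover have "r X <#> Y \<subseteq> r X <#> r Y" if "Y \<subseteq> carrier G" for X Y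
    using ext[OF that] by (intro mono_set_mult) auto
  ultimately show ?thesis
    using True unfolding nucleus_def by (meson subset_trans)
qed (simp add: nucleus_def)

text \<open>Since \<open>r (X <#> Y)\<close> is closed, it contains \<open>r X <#> r Y\<close>
  exactly when it contains the closure of that product. The opposite inclusion always holds, because
  \<open>r\<close> is expansive and monotone. The two conditions therefore agree for each pair
  \<open>X\<close>, \<open>Y\<close> separately.\<close>

lemma nucleus_iff_mult_closure:
  "nucleus G r \<longleftrightarrow> closure_operation (powerset_lattice (carrier G)) r \<and>
    (\<forall>X Y. X \<subseteq> carrier G \<longrightarrow> Y \<subseteq> carrier G \<longrightarrow> r (r X <#> r Y) = r (X <#> Y))"
  (is "_ \<longleftrightarrow> ?cl \<and> ?mult")
proof (cases ?cl)
  case True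
  note ext = closure_operation_powersetD(1)[OF True] and closed = closure_operation_powersetD(2)[OF True]
    and idem = closure_operation_powersetD(3)[OF True] and mono = closure_operation_powersetD(4)[OF True]
  have "r X <#> r Y \<subseteq> r (X <#> Y) \<longleftrightarrow> r (r X <#> r Y) = r (X <#> Y)"
    if X: "X \<subseteq> carrier G" and Y: "Y \<subseteq> carrier G" for X Y
  proof
    have XY: "X <#> Y \<subseteq> carrier G"
      using X Y by (rule set_mult_closed)
    have rXY: "r X <#> r Y \<subseteq> carrier G"
      using X Y by (intro set_mult_closed closed)
    show "r X <#> r Y \<subseteq> r (X <#> Y)" if "r (r X <#> r Y) = r (X <#> Y)"
      using ext[OF rXY] that by simp
    show "r (r X <#> r Y) = r (X <#> Y)" if "r X <#> r Y \<subseteq> r (X <#> Y)"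
    proof (rule subset_antisym)
      show "r (r X <#> r Y) \<subseteq> r (X <#> Y)"
        using mono[OF that closed[OF XY]] idem[OF XY] by simp
      show "r (X <#> Y) \<subseteq> r (r X <#> r Y)"
        using X Y by (intro mono rXY mono_set_mult ext)
    qed
  qed
  with True show ?thesis
    unfolding nucleus_def by simp
qed (simp add: nucleus_def)

lemma nucleus_iff_assoc:
  "nucleus G r \<longleftrightarrow> closure_operation (powerset_lattice (carrier G)) r \<and>
    (\<forall>X Y Z. X \<subseteq> carrier G \<longrightarrow> Y \<subseteq> carrier G \<longrightarrow> Z \<subseteq> carrier G \<longrightarrow>
      closure_mult G r (closure_mult G r X Y) Z = closure_mult G r X (closure_mult G r Y Z))"
  (is "_ \<longleftrightarrow> ?cl \<and> ?assoc")
proof (cases ?cl)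
  case True
  note ext = closure_operation_powersetD(1)[OF True] and closed = closure_operation_powersetD(2)[OF True]
    and idem = closure_operation_powersetD(3)[OF True] and mono = closure_operation_powersetD(4)[OF True]
  have "nucleus G r" if ?assoc
  proof -
    have "r X <#> Y \<subseteq> r (X <#> Y)" if X: "X \<subseteq> carrier G" and Y: "Y \<subseteq> carrier G" for X Y
    proof -
      \<comment> \<open>Because \<open>r\<close>-multiplication by \<open>{\<one>}\<close> amounts
        to applying \<open>r\<close>, the left side becomes \<open>r (r X <#> Y)\<close> and the
        right side, by idempotence, \<open>r (X <#> Y)\<close>.\<close>
      have "r (r ({\<one>} <#> X) <#> Y) = r ({\<one>} <#> r (X <#> Y))"
        using \<open>?assoc\<close> X Y unfolding closure_mult_def by simp
      then have "r (r X <#> Y) = r (X <#> Y)"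
        using X Y by (simp add: one_set_mult closed set_mult_closed idem)
      then show ?thesis
        using ext[OF set_mult_closed[OF closed[OF X] Y]] by simp
    qed
    with True show ?thesis
      unfolding nucleus_one_sided_iff by simp
  qed
  moreover have ?assoc if "nucleus G r"
  proof (intro allI impI)
    have mult: "r (r X <#> r Y) = r (X <#> Y)" if "X \<subseteq> carrier G" "Y \<subseteq> carrier G" for X Y
      using \<open>nucleus G r\<close> that unfolding nucleus_iff_mult_closure by simp
    \<comment> \<open>Replacing a factor by its closure leaves \<open>r (r X <#> r Y)\<close>
      unchanged by idempotence, so each one-sided form equals the two-sided one.\<close>
    have left: "r (r X <#> Y) = r (X <#> Y)" and right: "r (X <#> r Y) = r (X <#> Y)"
      if "X \<subseteq> carrier G" "Y \<subseteq> carrier G" for X Y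
      using mult[of "r X" Y] mult[of X "r Y"] mult[of X Y] that by (simp_all add: closed idem)
    fix X Y Z
    assume "X \<subseteq> carrier G" "Y \<subseteq> carrier G" "Z \<subseteq> carrier G"
    then show "closure_mult G r (closure_mult G r X Y) Z = closure_mult G r X (closure_mult G r Y Z)"
      by (simp add: closure_mult_def left right set_mult_closed subset_mult_assoc)
  qed
  ultimately show ?thesis
    using True by blast
qed (simp add: nucleus_def)

text \<open>The closure axioms are themselves encoded in the equivalence:
  \<open>X = {\<one>}\<close> extracts them, and general \<open>X\<close> adds compatibility with
  products. The assumption \<open>maps\<close> supplies that closures stay inside the
  carrier.\<close>

lemma nucleus_iff_mult_subset:
  assumes maps: "r \<in> Pow (carrier G) \<rightarrow> Pow (carrier G)"
  shows "nucleus G r \<longleftrightarrow>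
    (\<forall>X Y Z. X \<subseteq> carrier G \<longrightarrow> Y \<subseteq> carrier G \<longrightarrow> Z \<subseteq> carrier G \<longrightarrow>
      (X <#> Y \<subseteq> r Z \<longleftrightarrow> X <#> r Y \<subseteq> r Z))"
  (is "_ \<longleftrightarrow> ?adj")
proof
  assume nuc: "nucleus G r"
  then have cl: "closure_operation (powerset_lattice (carrier G)) r"
    unfolding nucleus_def by simp
  note ext = closure_operation_powersetD(1)[OF cl] and closed = closure_operation_powersetD(2)[OF cl]
    and idem = closure_operation_powersetD(3)[OF cl] and mono = closure_operation_powersetD(4)[OF cl]
  show ?adj
  proof (intro allI impI iffI)
    fix X Y Z
    assume X: "X \<subseteq> carrier G" and Y: "Y \<subseteq> carrier G" and Z: "Z \<subseteq> carrier G"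
    show "X <#> Y \<subseteq> r Z" if "X <#> r Y \<subseteq> r Z"
      using mono_set_mult[OF subset_refl ext[OF Y]] that by (rule subset_trans)
    assume "X <#> Y \<subseteq> r Z"
    have "X <#> r Y \<subseteq> r X <#> r Y"
      by (rule mono_set_mult[OF ext[OF X] subset_refl])
    also have "\<dots> \<subseteq> r (X <#> Y)"
      using nuc X Y unfolding nucleus_def by simp
    also have "\<dots> \<subseteq> r Z"
      using mono[OF \<open>X <#> Y \<subseteq> r Z\<close> closed[OF Z]] idem[OF Z] by simp
    finally show "X <#> r Y \<subseteq> r Z" .
  qed
next
  assume adj: ?adj
  have closed: "X \<subseteq> carrier G \<Longrightarrow> r X \<subseteq> carrier G" for X
    using maps by blast
  \<comment> \<open>This single equivalence characterizes closure operations: expansivity,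
    idempotence and monotonicity all follow by instantiating it.\<close>
  have galois: "X \<subseteq> r Y \<longleftrightarrow> r X \<subseteq> r Y" if "X \<subseteq> carrier G" "Y \<subseteq> carrier G" for X Y
    using adj[rule_format, of "{\<one>}" X Y] that by (simp add: one_set_mult closed)
  have ext: "X \<subseteq> r X" if "X \<subseteq> carrier G" for X
    using galois[OF that that] by simp
  have "closure_operation (powerset_lattice (carrier G)) r"
    unfolding closure_operation_powerset_iff
  proof (intro conjI allI impI)
    fix X assume X: "X \<subseteq> carrier G"
    show "X \<subseteq> r X" "r X \<subseteq> carrier G"
      using X by (rule ext, rule closed)
    show "r (r X) = r X"
      using galois[OF closed[OF X] X] ext[OF closed[OF X]] by simp
  next
    fix X Y assume "X \<subseteq> Y" and Y: "Y \<subseteq> carrier G"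
    then show "r X \<subseteq> r Y"
      using galois[of X Y] ext[OF Y] by (meson subset_trans)
  qed
  moreover have "r X <#> Y \<subseteq> r (X <#> Y)" if X: "X \<subseteq> carrier G" and Y: "Y \<subseteq> carrier G" for X Y
  proof -
    \<comment> \<open>Prepares \<open>adj\<close> with \<open>X <#> Y\<close> in the role of
      \<open>Z\<close>; the factor to be closed must stand on the right.\<close>
    have "Y <#> X \<subseteq> r (X <#> Y)"
      using ext[OF set_mult_closed[OF X Y]] subset_mult_commute[OF X Y] by simp
    then have "Y <#> r X \<subseteq> r (X <#> Y)"
      using adj X Y set_mult_closed[OF X Y] by simp
    then show ?thesis
      using subset_mult_commute[OF closed[OF X] Y] by simp
  qed
  ultimately show "nucleus G r"
    unfolding nucleus_one_sided_iff by simp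
qed

end

section \<open>Translations in the group with zero, and module systems\<close>

lemma carrier_adjoin_zero: "carrier (adjoin_zero G) = insert None (Some ` carrier G)"
  by (simp add: adjoin_zero_def)

lemma zero_l_coset_adjoin_zero:
  "X \<noteq> {} \<Longrightarrow> None <#\<^bsub>adjoin_zero G\<^esub> X = {None}"
  by (auto simp: l_coset_def adjoin_zero_def)

text \<open>Inverses in the group make translation by a nonzero element invertible on subsets; the
  adjoined zero is fixed by both translations.\<close>

lemma (in comm_group) l_coset_inv_adjoin_zero:
  assumes "a \<in> carrier G" "X \<subseteq> carrier (adjoin_zero G)"
  shows "Some a <#\<^bsub>adjoin_zero G\<^esub> (Some (inv a) <#\<^bsub>adjoin_zero G\<^esub> X) = X"
proof -
  have "Some a \<otimes>\<^bsub>adjoin_zero G\<^esub> (Some (inv a) \<otimes>\<^bsub>adjoin_zero G\<^esub> x) = x" if "x \<in> X" for x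
    using that assms by (auto simp: adjoin_zero_def m_assoc[symmetric])
  then show ?thesis
    by (auto simp: l_coset_def)
qed

text \<open>A translate is a product with a singleton, and any product is a union of translates. So
  the translation law gives the one-sided product inclusion, while the product law gives half of the
  translation law; inverses and the value of \<open>r {}\<close> give the other half.\<close>

lemma (in comm_group) module_system_iff_nucleus:
  "module_system G r \<longleftrightarrow> nucleus (adjoin_zero G) r \<and> r {} = {None}"
proof -
  let ?G0 = "adjoin_zero G"
  interpret G0: comm_monoid ?G0
    by (rule comm_monoid_adjoin_zero) (rule comm_group_axioms)
  have coset_closed: "c <#\<^bsub>?G0\<^esub> X \<subseteq> carrier ?G0" if "c \<in> carrier ?G0" "X \<subseteq> carrier ?G0" for c X
    unfolding l_coset_eq_set_mult using that by (intro G0.set_mult_closed) auto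
  show ?thesis
  proof (cases "closure_operation (powerset_lattice (carrier ?G0)) r \<and> r {} = {None}")
    case True
    then have cl: "closure_operation (powerset_lattice (carrier ?G0)) r" and empty: "r {} = {None}"
      by simp_all
    note ext = closure_operation_powersetD(1)[OF cl] and closed = closure_operation_powersetD(2)[OF cl]
      and idem = closure_operation_powersetD(3)[OF cl] and mono = closure_operation_powersetD(4)[OF cl]
    have "r X <#>\<^bsub>?G0\<^esub> Y \<subseteq> r (X <#>\<^bsub>?G0\<^esub> Y)"
      if "module_system G r" and X: "X \<subseteq> carrier ?G0" and Y: "Y \<subseteq> carrier ?G0" for X Y
    proof -
      \<comment> \<open>\<open>Y <#> r X\<close> is the union of these translates, so bounding each
        one suffices.\<close>
      have "y <#\<^bsub>?G0\<^esub> r X \<subseteq> r (Y <#>\<^bsub>?G0\<^esub> X)" if "y \<in> Y" for y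
      proof -
        have "y <#\<^bsub>?G0\<^esub> r X = r (y <#\<^bsub>?G0\<^esub> X)"
          using \<open>module_system G r\<close> X Y that unfolding module_system_def by (auto dest: subsetD)
        also have "\<dots> \<subseteq> r (Y <#>\<^bsub>?G0\<^esub> X)"
          unfolding l_coset_eq_set_mult using that X Y
          by (intro mono mono_set_mult G0.set_mult_closed) auto
        finally show ?thesis .
      qed
      then have "Y <#>\<^bsub>?G0\<^esub> r X \<subseteq> r (Y <#>\<^bsub>?G0\<^esub> X)"
        by (auto simp: set_mult_def l_coset_def)
      then show ?thesis
        using G0.subset_mult_commute[OF closed[OF X] Y] G0.subset_mult_commute[OF X Y] by simp
    qed
    moreover have "r (c <#\<^bsub>?G0\<^esub> X) = c <#\<^bsub>?G0\<^esub> r X"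
      if "nucleus ?G0 r" and c: "c \<in> carrier ?G0" and X: "X \<subseteq> carrier ?G0" for c X
    proof -
      have sub: "d <#\<^bsub>?G0\<^esub> r Y \<subseteq> r (d <#\<^bsub>?G0\<^esub> Y)"
        if d: "d \<in> carrier ?G0" and Y: "Y \<subseteq> carrier ?G0" for d Y
      proof -
        have "d <#\<^bsub>?G0\<^esub> r Y \<subseteq> r {d} <#>\<^bsub>?G0\<^esub> r Y"
          unfolding l_coset_eq_set_mult using ext[of "{d}"] d by (intro mono_set_mult) auto
        also have "\<dots> \<subseteq> r (d <#\<^bsub>?G0\<^esub> Y)"
          using \<open>nucleus ?G0 r\<close> d Y unfolding nucleus_def l_coset_eq_set_mult by simp
        finally show ?thesis .
      qed
      show ?thesis
      proof (cases c)
        case None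
        \<comment> \<open>This makes \<open>r X\<close> nonempty even for empty \<open>X\<close>, so
          multiplying it by zero gives exactly \<open>{None}\<close>.\<close>
        have "{None} \<subseteq> r X"
          using mono[OF empty_subsetI X] empty by simp
        then have "c <#\<^bsub>?G0\<^esub> r X = {None}"
          using zero_l_coset_adjoin_zero None by blast
        moreover have "r (c <#\<^bsub>?G0\<^esub> X) = {None}"
        \<comment> \<open>The zero translate of the empty set is empty, with closure
          \<open>{None}\<close> by assumption; otherwise the translate is \<open>{None}\<close>,
          which is closed as a value of \<open>r\<close>.\<close>
        proof (cases "X = {}")
          case True
          then show ?thesis by (simp add: l_coset_def empty)
        next
          case False
          then show ?thesis
            using idem[of "{}"] None by (simp add: zero_l_coset_adjoin_zero empty)
        qed
        ultimately show ?thesis by simp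
      next
        case (Some a)
        with c have a: "a \<in> carrier G" and inv_a: "Some (inv a) \<in> carrier ?G0"
          by (auto simp: carrier_adjoin_zero)
        \<comment> \<open>The missing inclusion comes from \<open>sub\<close> applied to the inverse
          of \<open>c\<close> and the translate of \<open>X\<close> by \<open>c\<close>, followed by
          multiplication by \<open>c\<close>.\<close>
        have "Some (inv a) <#\<^bsub>?G0\<^esub> (c <#\<^bsub>?G0\<^esub> X) = X"
          using l_coset_inv_adjoin_zero[of "inv a" X] a X Some by simp
        then have "Some (inv a) <#\<^bsub>?G0\<^esub> r (c <#\<^bsub>?G0\<^esub> X) \<subseteq> r X"
          using sub[OF inv_a coset_closed[OF c X]] by simp
        then have "c <#\<^bsub>?G0\<^esub> (Some (inv a) <#\<^bsub>?G0\<^esub> r (c <#\<^bsub>?G0\<^esub> X)) \<subseteq> c <#\<^bsub>?G0\<^esub> r X"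
          unfolding l_coset_eq_set_mult by (intro mono_set_mult) auto
        then have "r (c <#\<^bsub>?G0\<^esub> X) \<subseteq> c <#\<^bsub>?G0\<^esub> r X"
          using l_coset_inv_adjoin_zero[OF a closed[OF coset_closed[OF c X]]] Some by simp
        with sub[OF c X] show ?thesis by blast
      qed
    qed
    ultimately show ?thesis
      using True unfolding module_system_def by (auto simp: G0.nucleus_one_sided_iff)
  qed (auto simp: module_system_def nucleus_def)
qed

theorem theorem10p1:
  fixes G :: "('a, 'b) monoid_scheme"
  assumes "comm_group G"
  defines "G0 \<equiv> adjoin_zero G"
  shows "(\<forall>r. module_system G r \<longleftrightarrow> nucleus G0 r \<and> r {} = {None}) \<and>
    (\<forall>r \<in> Pow (carrier G0) \<rightarrow> Pow (carrier G0). r {} = {None} \<longrightarrow>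
      (module_system G r \<longleftrightarrow>
        closure_operation (powerset_lattice (carrier G0)) r \<and>
        (\<forall>X Y Z. X \<subseteq> carrier G0 \<longrightarrow> Y \<subseteq> carrier G0 \<longrightarrow> Z \<subseteq> carrier G0 \<longrightarrow>
           closure_mult G0 r (closure_mult G0 r X Y) Z =
           closure_mult G0 r X (closure_mult G0 r Y Z))) \<and>
      (module_system G r \<longleftrightarrow>
        closure_operation (powerset_lattice (carrier G0)) r \<and>
        (\<forall>X Y. X \<subseteq> carrier G0 \<longrightarrow> Y \<subseteq> carrier G0 \<longrightarrow>
           r (r X <#>\<^bsub>G0\<^esub> r Y) = r (X <#>\<^bsub>G0\<^esub> Y))) \<and>
      (module_system G r \<longleftrightarrow>
        (\<forall>X Y Z. X \<subseteq> carrier G0 \<longrightarrow> Y \<subseteq> carrier G0 \<longrightarrow> Z \<subseteq> carrier G0 \<longrightarrow>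
           (X <#>\<^bsub>G0\<^esub> Y \<subseteq> r Z \<longleftrightarrow> X <#>\<^bsub>G0\<^esub> r Y \<subseteq> r Z))))"
proof -
  interpret comm_group G by fact
  interpret G0: comm_monoid G0
    unfolding G0_def by (rule comm_monoid_adjoin_zero) fact
  have nucleus: "module_system G r \<longleftrightarrow> nucleus G0 r \<and> r {} = {None}" for r
    unfolding G0_def by (rule module_system_iff_nucleus)
  show ?thesis
  proof (intro conjI ballI allI impI)
    fix r assume r: "r \<in> Pow (carrier G0) \<rightarrow> Pow (carrier G0)" and "r {} = {None}"
    \<comment> \<open>Once the value at the empty set is fixed, the two notions coincide, and the
      three descriptions of nuclei carry over by folding with \<open>eq\<close>.\<close>
    then have eq: "module_system G r = nucleus G0 r"
      by (simp add: nucleus)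
    note G0.nucleus_iff_assoc[of r, folded eq]
      G0.nucleus_iff_mult_closure[of r, folded eq]
      G0.nucleus_iff_mult_subset[OF r, folded eq]
    then show "module_system G r \<longleftrightarrow>
        closure_operation (powerset_lattice (carrier G0)) r \<and>
        (\<forall>X Y Z. X \<subseteq> carrier G0 \<longrightarrow> Y \<subseteq> carrier G0 \<longrightarrow> Z \<subseteq> carrier G0 \<longrightarrow>
           closure_mult G0 r (closure_mult G0 r X Y) Z =
           closure_mult G0 r X (closure_mult G0 r Y Z))"
      "module_system G r \<longleftrightarrow>
        closure_operation (powerset_lattice (carrier G0)) r \<and>
        (\<forall>X Y. X \<subseteq> carrier G0 \<longrightarrow> Y \<subseteq> carrier G0 \<longrightarrow>
           r (r X <#>\<^bsub>G0\<^esub> r Y) = r (X <#>\<^bsub>G0\<^esub> Y))"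
      "module_system G r \<longleftrightarrow>
        (\<forall>X Y Z. X \<subseteq> carrier G0 \<longrightarrow> Y \<subseteq> carrier G0 \<longrightarrow> Z \<subseteq> carrier G0 \<longrightarrow>
           (X <#>\<^bsub>G0\<^esub> Y \<subseteq> r Z \<longleftrightarrow> X <#>\<^bsub>G0\<^esub> r Y \<subseteq> r Z))"
      by this+
  qed (rule nucleus)
qed

end
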